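(* Let $n \ge k \ge 3$ be integers such that $\frac{(n-2)!}{k!(n-k)!} \in \mathbb{Z}$. Then \[ \sum_{G, H} (-1)^{|\mathbf{E}(H)|} \cos \!\left( \frac{4\pi}{k(k-1)} \cdot \mathrm{i}(G,H) \right) = 0 \] if and only if $n \ge R(k)$, where the sum runs over all finite simple undirected graphs $G$ on the vertex set $[n]$ and all $k$-uniform hypergraphs $H$ on the vertex set $[n]$.
   Context: $[n]=\{1,\dots,n\}$. A $k$-uniform hypergraph $H$ on $[n]$ is a pair $([n],\mathbf{E}(H))$ with $\mathbf{E}(H) \subseteq \binom{[n]}{k}$ (the set of $k$-element subsets of $[n]$); $\mathbf{E}(G)\subseteq\binom{[n]}{2}$ is the edge set of a graph $G$. The incidence number is $\mathrm{i}(G,H) := \#\{(u,v) \in \mathbf{E}(G)\times \mathbf{E}(H) : u \subseteq v\}$. The $k$-th diagonal Ramsey number $R(k)$ is the least positive integer $n$ such that every graph on $n$ vertices contains a clique of size $k$ or an independent set of size $k$. *)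

theory Defs
  imports Complex_Main "HOL-Library.Ramsey"
begin

text \<open>As the vertex set \<open>{1..n}\<close> is fixed, a hypergraph on it is identified with its edge set.\<close>

definition uniform_hypergraphs :: "nat \<Rightarrow> nat \<Rightarrow> nat set set set" where
  "uniform_hypergraphs k n = Pow ([{1..n}]\<^bsup>k\<^esup>)"

definition simple_graphs :: "nat \<Rightarrow> nat set set set" where
  "simple_graphs n = Pow ([{1..n}]\<^bsup>2\<^esup>)"

definition incidence_number :: "nat set set \<Rightarrow> nat set set \<Rightarrow> nat" where
  "incidence_number G H = card {(u, v). u \<in> G \<and> v \<in> H \<and> u \<subseteq> v}"

definition ramsey_property :: "nat \<Rightarrow> nat \<Rightarrow> bool" where
  "ramsey_property k n \<longleftrightarrow>
     (\<forall>(V :: nat set) E. finite V \<and> card V = n \<and> E \<subseteq> [V]\<^bsup>2\<^esup> \<longrightarrow>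
        (\<exists>K \<subseteq> V. card K = k \<and> (clique K E \<or> indep K E)))"

definition ramsey_number :: "nat \<Rightarrow> nat" where
  "ramsey_number k = (LEAST n. n > 0 \<and> ramsey_property k n)"

text \<open>The minimum in the definition of the Ramsey number is attained.\<close>

lemma ramsey_property_ramsey_number: "ramsey_number k > 0 \<and> ramsey_property k (ramsey_number k)"
proof -
  obtain r where r: "r \<ge> 1"
    "\<forall>(V :: nat set) E. finite V \<and> card V \<ge> r \<longrightarrow>
       (\<exists>K \<subseteq> V. card K = k \<and> clique K E \<or> card K = k \<and> indep K E)"
    using ramsey2[of k k] by blast
  then have "r > 0 \<and> ramsey_property k r"
    unfolding ramsey_property_def by (metis order_refl less_eq_Suc_le One_nat_def)
  then show ?thesis
    unfolding ramsey_number_def by (rule LeastI)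
qed

end

theory Submission
  imports Defs
begin

text \<open>
  For fixed \<open>G\<close> let \<open>e v\<close> be the number of edges of \<open>G\<close> inside a \<open>k\<close>-set \<open>v\<close>, and let
  \<open>\<theta> = 2 * pi / (k choose 2)\<close>. Since \<open>H\<close> ranges over all sets of \<open>k\<close>-sets, the sum over \<open>H\<close> is the
  real part of the product of the factors \<open>1 - cis (\<theta> * e v)\<close>, each of which has modulus
  \<open>2 * sin (\<theta> * e v / 2)\<close> and argument \<open>\<theta> * e v / 2 - pi / 2\<close>. The divisibility hypothesis says
  exactly that \<open>k * (k - 1)\<close> divides \<open>(n - 2) choose (k - 2)\<close>, the number of \<open>k\<close>-sets containing
  a given edge, and it makes \<open>n choose k\<close> even; hence all products are real, with a common sign
  independent of \<open>G\<close>. So the total vanishes iff for every \<open>G\<close> some sine vanishes, i.e. some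
  \<open>k\<close>-set spans either no edge or all \<open>k choose 2\<close> edges of \<open>G\<close>.
\<close>

section \<open>Alternating cosine sums as products of sines\<close>

text \<open>Half-angle formulas. The real factor may be negative, so for general \<open>t\<close>
  this is a polar form only up to sign.\<close>

lemma one_minus_cis: "1 - cis t = of_real (2 * sin (t / 2)) * cis (t / 2 - pi / 2)"
proof -
  have "cos t = 1 - 2 * (sin (t / 2))\<^sup>2" "sin t = 2 * sin (t / 2) * cos (t / 2)"
    using cos_double_sin[of "t / 2"] sin_double[of "t / 2"] by simp_all
  then show ?thesis
    by (simp add: complex_eq_iff power2_eq_square cos_diff sin_diff)
qed

lemma prod_cis: "finite A \<Longrightarrow> (\<Prod>x\<in>A. cis (f x)) = cis (\<Sum>x\<in>A. f x)"
  by (induction A rule: finite_induct) (simp_all add: cis_mult)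

text \<open>Expanding the product of all \<open>1 - cis (f v)\<close> over subsets of
  \<open>A\<close> yields the left side as its real part; the half-angle form of each factor yields
  the right side.\<close>

lemma alternating_sum_cos:
  assumes "finite A"
  shows "(\<Sum>H\<in>Pow A. (-1) ^ card H * cos (\<Sum>v\<in>H. f v)) =
         (\<Prod>v\<in>A. 2 * sin (f v / 2)) * cos ((\<Sum>v\<in>A. f v) / 2 - real (card A) * pi / 2)"
proof -
  have term_eq: "(-1) ^ card H * cos (\<Sum>v\<in>H. f v) = Re (\<Prod>v\<in>H. - cis (f v))" if "H \<in> Pow A" for H
  proof -
    have "finite H"
      using that assms finite_subset by auto
    then have "(\<Prod>v\<in>H. - cis (f v)) = of_real ((-1) ^ card H) * cis (\<Sum>v\<in>H. f v)"
      by (simp add: prod_uminus prod_cis)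
    then show ?thesis
      by (simp del: of_real_power of_real_minus)
  qed
  have "(\<Sum>H\<in>Pow A. (-1) ^ card H * cos (\<Sum>v\<in>H. f v)) = Re (\<Sum>H\<in>Pow A. \<Prod>v\<in>H. - cis (f v))"
    using term_eq by simp
  also have "(\<Sum>H\<in>Pow A. \<Prod>v\<in>H. - cis (f v)) = (\<Prod>v\<in>A. 1 - cis (f v))"
    using prod_add[OF assms, of "\<lambda>v. - cis (f v)" "\<lambda>_. 1"] by simp
  also have "\<dots> = of_real (\<Prod>v\<in>A. 2 * sin (f v / 2)) * cis (\<Sum>v\<in>A. f v / 2 - pi / 2)"
    unfolding one_minus_cis prod.distrib[of "\<lambda>v. of_real (2 * sin (f v / 2))"] prod_cis[OF assms] of_real_prod
    by (rule refl)
  also have "(\<Sum>v\<in>A. f v / 2 - pi / 2) = (\<Sum>v\<in>A. f v) / 2 - real (card A) * pi / 2"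
    by (simp add: sum_subtractf sum_divide_distrib)
  finally show ?thesis
    by (simp del: of_real_prod)
qed

section \<open>Counting edges inside \<open>k\<close>-sets\<close>

lemma card_nsets_superset:
  assumes "finite A" "u \<subseteq> A" "card u \<le> k"
  shows "card {v \<in> [A]\<^bsup>k\<^esup>. u \<subseteq> v} = (card A - card u) choose (k - card u)"
proof -
  have u: "finite u"
    using assms finite_subset by blast
  have "bij_betw (\<lambda>v. v - u) {v \<in> [A]\<^bsup>k\<^esup>. u \<subseteq> v} {w. w \<subseteq> A - u \<and> card w = k - card u}"
  proof (rule bij_betwI[where g = "\<lambda>w. w \<union> u"])
    show "(\<lambda>v. v - u) \<in> {v \<in> [A]\<^bsup>k\<^esup>. u \<subseteq> v} \<rightarrow> {w. w \<subseteq> A - u \<and> card w = k - card u}"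
      by (auto simp: nsets_def card_Diff_subset u)
    show "(\<lambda>w. w \<union> u) \<in> {w. w \<subseteq> A - u \<and> card w = k - card u} \<rightarrow> {v \<in> [A]\<^bsup>k\<^esup>. u \<subseteq> v}"
    proof
      fix w assume w: "w \<in> {w. w \<subseteq> A - u \<and> card w = k - card u}"
      then have "finite w" "w \<inter> u = {}"
        using assms finite_subset[of w A] by auto
      then have "card (w \<union> u) = k"
        using w u assms by (simp add: card_Un_disjoint)
      then show "w \<union> u \<in> {v \<in> [A]\<^bsup>k\<^esup>. u \<subseteq> v}"
        using w assms \<open>finite w\<close> u by (auto simp: nsets_def)
    qed
  qed auto
  then show ?thesis
    using assms u by (simp add: bij_betw_same_card n_subsets card_Diff_subset)
qed

text \<open>Double counting of pairs of an edge and a \<open>k\<close>-set containing it: each edge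
  lies in the same number of \<open>k\<close>-sets.\<close>

lemma sum_edges_inside_nsets:
  assumes "finite A" "G \<subseteq> [A]\<^bsup>2\<^esup>" "2 \<le> k"
  shows "(\<Sum>v\<in>[A]\<^bsup>k\<^esup>. card {u \<in> G. u \<subseteq> v}) = (card A - 2 choose (k - 2)) * card G"
proof (rule sum_multicount)
  show "finite ([A]\<^bsup>k\<^esup>)" "finite G"
    using assms finite_imp_finite_nsets finite_subset by blast+
  show "\<forall>u\<in>G. card {v \<in> [A]\<^bsup>k\<^esup>. u \<subseteq> v} = (card A - 2 choose (k - 2))"
  proof
    fix u assume "u \<in> G"
    then have "u \<subseteq> A" "card u = 2"
      using assms by (auto simp: nsets_def)
    then show "card {v \<in> [A]\<^bsup>k\<^esup>. u \<subseteq> v} = (card A - 2 choose (k - 2))"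
      using card_nsets_superset[of A u k] assms by simp
  qed
qed

lemma incidence_number_eq_sum:
  assumes "finite G" "finite H"
  shows "incidence_number G H = (\<Sum>v\<in>H. card {u \<in> G. u \<subseteq> v})"
proof -
  have "{(u, v). u \<in> G \<and> v \<in> H \<and> u \<subseteq> v} = prod.swap ` (SIGMA v:H. {u \<in> G. u \<subseteq> v})"
    by auto
  then show ?thesis
    unfolding incidence_number_def using assms by (simp add: card_image card_SigmaI)
qed

lemma edges_inside_eq:
  assumes "G \<subseteq> [A]\<^bsup>2\<^esup>"
  shows "{u \<in> G. u \<subseteq> v} = G \<inter> [v]\<^bsup>2\<^esup>"
  using assms by (auto simp: nsets_def)

lemma card_nsets:
  assumes "finite v"
  shows "card ([v]\<^bsup>r\<^esup>) = card v choose r"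
proof -
  have "[v]\<^bsup>r\<^esup> = {w. w \<subseteq> v \<and> card w = r}"
    using assms finite_subset by (auto simp: nsets_def)
  then show ?thesis
    using n_subsets[OF assms, of r] by simp
qed

lemma indep_iff_no_edge_inside:
  assumes "G \<subseteq> [A]\<^bsup>2\<^esup>" "finite G"
  shows "indep v G \<longleftrightarrow> card {u \<in> G. u \<subseteq> v} = 0"
proof -
  have "indep v G \<longleftrightarrow> G \<inter> [v]\<^bsup>2\<^esup> = {}"
    by (auto simp: indep_def nsets_2_eq)
  then show ?thesis
    using assms(2) unfolding edges_inside_eq[OF assms(1)] by simp
qed

text \<open>The edges inside \<open>v\<close> form a subset of the finite set of all pairs from
  \<open>v\<close>, so equal cardinality forces equality.\<close>

lemma clique_iff_all_edges_inside:
  assumes "G \<subseteq> [A]\<^bsup>2\<^esup>" "finite v"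
  shows "clique v G \<longleftrightarrow> card {u \<in> G. u \<subseteq> v} = card v choose 2"
proof -
  have "clique v G \<longleftrightarrow> [v]\<^bsup>2\<^esup> \<subseteq> G"
    by (auto simp: clique_def nsets_2_eq)
  also have "\<dots> \<longleftrightarrow> G \<inter> [v]\<^bsup>2\<^esup> = [v]\<^bsup>2\<^esup>"
    by blast
  also have "\<dots> \<longleftrightarrow> card (G \<inter> [v]\<^bsup>2\<^esup>) = card ([v]\<^bsup>2\<^esup>)"
    using card_subset_eq[OF finite_imp_finite_nsets[OF assms(2)] Int_lower2] by metis
  finally show ?thesis
    unfolding edges_inside_eq[OF assms(1)] card_nsets[OF assms(2)] .
qed

lemma card_edges_inside_le:
  assumes "G \<subseteq> [A]\<^bsup>2\<^esup>" "finite v"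
  shows "card {u \<in> G. u \<subseteq> v} \<le> card v choose 2"
  unfolding edges_inside_eq[OF assms(1)] card_nsets[OF assms(2), symmetric]
  using assms(2) by (intro card_mono finite_imp_finite_nsets) auto

section \<open>The Ramsey property\<close>

lemma ramsey_property_mono:
  assumes "ramsey_property k m" "m \<le> n"
  shows "ramsey_property k n"
  unfolding ramsey_property_def
proof (intro allI impI, elim conjE)
  fix V :: "nat set" and E
  assume V: "finite V" "card V = n" "E \<subseteq> [V]\<^bsup>2\<^esup>"
  obtain W where W: "W \<subseteq> V" "card W = m" "finite W"
    using V assms(2) by (metis obtain_subset_with_card_n)
  \<comment> \<open>The property applies to the subgraph induced on \<open>W\<close>, which has the
    same edges inside \<open>K\<close> as \<open>E\<close>.\<close>
  then obtain K where K: "K \<subseteq> W" "card K = k" "clique K (E \<inter> [W]\<^bsup>2\<^esup>) \<or> indep K (E \<inter> [W]\<^bsup>2\<^esup>)"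
    using assms(1) unfolding ramsey_property_def by (metis inf_le2)
  moreover from K have "clique K E \<or> indep K E"
    by (auto simp: clique_def indep_def subset_iff)
  ultimately show "\<exists>K\<subseteq>V. card K = k \<and> (clique K E \<or> indep K E)"
    using W by blast
qed

lemma ramsey_number_le_iff:
  assumes "n > 0"
  shows "ramsey_number k \<le> n \<longleftrightarrow> ramsey_property k n"
proof
  show "ramsey_number k \<le> n \<Longrightarrow> ramsey_property k n"
    using ramsey_property_mono ramsey_property_ramsey_number by blast
  show "ramsey_property k n \<Longrightarrow> ramsey_number k \<le> n"
    unfolding ramsey_number_def using assms by (intro Least_le) simp
qed

text \<open>Only the size of the vertex set matters: a graph on any \<open>V\<close> is pulled back
  along a bijection from \<open>{1..n}\<close>, and the set found there is pushed forward.\<close>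

lemma ramsey_property_iff_simple_graphs:
  "ramsey_property k n \<longleftrightarrow>
    (\<forall>G\<in>simple_graphs n. \<exists>K\<subseteq>{1..n}. card K = k \<and> (clique K G \<or> indep K G))"
proof
  assume "ramsey_property k n"
  then show "\<forall>G\<in>simple_graphs n. \<exists>K\<subseteq>{1..n}. card K = k \<and> (clique K G \<or> indep K G)"
    unfolding ramsey_property_def simple_graphs_def by simp
next
  assume R: "\<forall>G\<in>simple_graphs n. \<exists>K\<subseteq>{1..n}. card K = k \<and> (clique K G \<or> indep K G)"
  show "ramsey_property k n"
    unfolding ramsey_property_def
  proof (intro allI impI, elim conjE)
    fix V :: "nat set" and E
    assume V: "finite V" "card V = n" "E \<subseteq> [V]\<^bsup>2\<^esup>"
    obtain f where f: "bij_betw f {1..n} V"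
      using V by (metis finite_same_card_bij finite_atLeastAtMost card_atLeastAtMost diff_Suc_1)
    define G where "G = {u \<in> [{1..n}]\<^bsup>2\<^esup>. f ` u \<in> E}"
    have "G \<in> simple_graphs n"
      by (auto simp: G_def simple_graphs_def)
    then obtain K where K: "K \<subseteq> {1..n}" "card K = k" "clique K G \<or> indep K G"
      using R by blast
    have inj: "inj_on f K"
      using f K(1) by (metis bij_betw_def inj_on_subset)
    have "clique (f ` K) E" if "clique K G"
      using that by (force simp: clique_def G_def)
    moreover have "indep (f ` K) E" if "indep K G"
      using that K(1) by (force simp: indep_def G_def)
    moreover have "f ` K \<subseteq> V" "card (f ` K) = k"
      using K f inj by (auto simp: card_image bij_betw_def)
    ultimately show "\<exists>K\<subseteq>V. card K = k \<and> (clique K E \<or> indep K E)"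
      using K(3) by blast
  qed
qed

section \<open>Signs and zeros of the sine factors\<close>

lemma sin_pi_frac_nonneg:
  assumes "m \<le> N"
  shows "0 \<le> sin (pi * real m / real N)"
proof (rule sin_ge_zero)
  show "pi * real m / real N \<le> pi"
    \<comment> \<open>For \<open>N = 0\<close> the quotient is 0 by the convention on
      division.\<close>
    using assms by (cases "N = 0") (simp_all add: field_simps)
qed simp

lemma sin_pi_frac_eq_0_iff:
  assumes "m \<le> N" "N > 0"
  shows "sin (pi * real m / real N) = 0 \<longleftrightarrow> m = 0 \<or> m = N"
proof -
  have "sin (pi * real m / real N) > 0" if "m \<noteq> 0" "m \<noteq> N"
    using assms that by (intro sin_gt_zero) (simp_all add: field_simps)
  then show ?thesis
    using assms by fastforce
qed

section \<open>Divisibility and the common sign\<close>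

text \<open>Both binomials are multiples of the same integer \<open>m\<close>, the quotient in the
  hypothesis. The first equation controls the phase of the product, the second gives the parity of
  the number of \<open>k\<close>-sets.\<close>

lemma binomial_multiples:
  assumes "n \<ge> k" "k \<ge> 2" "(fact (n - 2) / (fact k * fact (n - k)) :: real) \<in> \<int>"
  obtains m :: nat where "n - 2 choose (k - 2) = m * (k * (k - 1))" "n choose k = m * (n * (n - 1))"
proof -
  have "(fact (n - 2) / (fact k * fact (n - k)) :: real) \<in> \<nat>"
    using assms(3) by (simp add: Nats_altdef2)
  then obtain m :: nat where m: "(fact (n - 2) / (fact k * fact (n - k)) :: real) = of_nat m"
    by (auto elim: Nats_cases)
  then have "real (fact (n - 2)) = real (m * (fact k * fact (n - k)))"
    by (simp add: field_simps)
  then have fact_eq: "fact (n - 2) = m * (fact k * fact (n - k))"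
    by (simp only: of_nat_eq_iff)
  have fact_split: "fact j = j * (j - 1) * (fact (j - 2) :: nat)" if "j \<ge> 2" for j
    using that fact_reduce[of j, where 'a = nat] fact_reduce[of "j - 1", where 'a = nat]
    by (simp add: numeral_2_eq_2)
  show ?thesis
  proof
    have "fact (k - 2) * fact (n - k) * (n - 2 choose (k - 2)) = fact (n - 2)"
    proof -
      have "k - 2 \<le> n - 2" "n - 2 - (k - 2) = n - k"
        using assms by simp_all
      then show ?thesis
        using binomial_fact_lemma[of "k - 2" "n - 2"] by metis
    qed
    also have "\<dots> = fact (k - 2) * fact (n - k) * (m * (k * (k - 1)))"
      using fact_eq fact_split[of k] assms by simp
    finally show "n - 2 choose (k - 2) = m * (k * (k - 1))"
      by simp
    have "fact k * fact (n - k) * (n choose k) = fact n"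
      using binomial_fact_lemma[of k n] assms by simp
    also have "\<dots> = fact k * fact (n - k) * (m * (n * (n - 1)))"
      using fact_eq fact_split[of n] assms by simp
    finally show "n choose k = m * (n * (n - 1))"
      by simp
  qed
qed

text \<open>The edge counts add up to a multiple of \<open>k * (k - 1)\<close>, so their share of
  the phase is a multiple of \<open>2 * pi\<close>. What remains is \<open>- M * pi\<close>, giving
  a sign that does not depend on \<open>G\<close>.\<close>

lemma sum_hypergraphs_eq_prod_sin:
  assumes nk: "n \<ge> k" "k \<ge> 2" and G: "G \<in> simple_graphs n"
    and m1: "n - 2 choose (k - 2) = m * (k * (k - 1))" and M: "n choose k = 2 * M"
  shows "(\<Sum>H\<in>uniform_hypergraphs k n.
            (-1) ^ card H * cos (4 * pi / (real k * (real k - 1)) * real (incidence_number G H))) =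
         (-1) ^ M * (\<Prod>v\<in>[{1..n}]\<^bsup>k\<^esup>. 2 * sin (pi * real (card {u \<in> G. u \<subseteq> v}) / real (k choose 2)))"
proof -
  let ?A = "[{1..n}]\<^bsup>k\<^esup>" and ?e = "\<lambda>v. card {u \<in> G. u \<subseteq> v}"
  define \<theta> where "\<theta> = 4 * pi / (real k * (real k - 1))"
  have G2: "G \<subseteq> [{1..n}]\<^bsup>2\<^esup>"
    using G by (simp add: simple_graphs_def)
  then have fG: "finite G"
    using finite_imp_finite_nsets[of "{1..n}" 2] finite_subset by blast
  have fA: "finite ?A"
    by (simp add: finite_imp_finite_nsets)
  have kk: "real (k * (k - 1)) = real k * (real k - 1)" "real k * (real k - 1) \<noteq> 0"
    using nk by (auto simp: of_nat_diff)
  \<comment> \<open>Evenness makes the natural-number division in \<open>choose_two\<close> exact,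
    so it carries over to the reals.\<close>
  have "even (k * (k - 1))"
    by auto
  then have choose2: "real (k choose 2) = real k * (real k - 1) / 2"
    using kk(1) by (simp add: choose_two real_of_nat_div)
  have half: "\<theta> * x / 2 = pi * x / real (k choose 2)" for x
    unfolding \<theta>_def choose2 by simp
  have "(\<Sum>v\<in>?A. real (?e v)) = real m * (real k * (real k - 1)) * real (card G)"
    using sum_edges_inside_nsets[OF _ G2 nk(2)] m1 kk(1)
    by (simp flip: of_nat_sum)
  then have total: "(\<Sum>v\<in>?A. \<theta> * real (?e v)) / 2 = 2 * real (m * card G) * pi"
    using kk(2) unfolding sum_distrib_left[symmetric] \<theta>_def by simp
  have "card ?A = 2 * M"
    using M by (simp add: card_nsets)
  then have phase: "(\<Sum>v\<in>?A. \<theta> * real (?e v)) / 2 - real (card ?A) * pi / 2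
      = 2 * real (m * card G) * pi - real M * pi"
    using total by simp
  have "(\<Sum>H\<in>Pow ?A. (-1) ^ card H * cos (\<theta> * real (incidence_number G H)))
      = (\<Sum>H\<in>Pow ?A. (-1) ^ card H * cos (\<Sum>v\<in>H. \<theta> * real (?e v)))"
  proof (rule sum.cong[OF refl])
    fix H assume "H \<in> Pow ?A"
    then have "finite H"
      using fA finite_subset by blast
    then show "(-1) ^ card H * cos (\<theta> * real (incidence_number G H))
        = (-1) ^ card H * cos (\<Sum>v\<in>H. \<theta> * real (?e v))"
      by (simp add: incidence_number_eq_sum[OF fG] flip: sum_distrib_left)
  qed
  also have "\<dots> = (\<Prod>v\<in>?A. 2 * sin (\<theta> * real (?e v) / 2)) * cos (2 * real (m * card G) * pi - real M * pi)"
    by (simp only: alternating_sum_cos[OF fA] phase)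
  also have "cos (2 * real (m * card G) * pi - real M * pi) = (-1) ^ M"
    by (simp only: cos_diff cos_2npi sin_2npi cos_npi)
  finally show ?thesis
    unfolding uniform_hypergraphs_def half by (simp add: \<theta>_def mult.commute)
qed

theorem theorem2p2:
  fixes n k :: nat
  assumes "n \<ge> k" and "k \<ge> 3"
    and "(fact (n - 2) / (fact k * fact (n - k)) :: real) \<in> \<int>"
  shows "(\<Sum>G\<in>simple_graphs n. \<Sum>H\<in>uniform_hypergraphs k n.
            (-1) ^ card H * cos (4 * pi / (real k * (real k - 1)) * real (incidence_number G H))) = 0
         \<longleftrightarrow> n \<ge> ramsey_number k"
proof -
  let ?A = "[{1..n}]\<^bsup>k\<^esup>" and ?N = "k choose 2"
  let ?e = "\<lambda>G v. card {u \<in> G. u \<subseteq> v}"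
  let ?P = "\<lambda>G. \<Prod>v\<in>?A. 2 * sin (pi * real (?e G v) / real ?N)"
  have k2: "k \<ge> 2"
    using assms(2) by simp
  then have N: "?N > 0"
    by (simp add: zero_less_binomial)
  obtain m where m: "n - 2 choose (k - 2) = m * (k * (k - 1))" "n choose k = m * (n * (n - 1))"
    using binomial_multiples[OF assms(1) k2 assms(3)] by blast
  \<comment> \<open>One of the consecutive numbers \<open>n - 1\<close> and \<open>n\<close> is
    even.\<close>
  have "even (n choose k)"
    unfolding m(2) by auto
  then obtain M where M: "n choose k = 2 * M"
    by (elim evenE)
  have fA: "finite ?A" and fG: "finite (simple_graphs n)"
    by (simp_all add: simple_graphs_def finite_imp_finite_nsets)
  have v: "finite v" "card v = k" if "v \<in> ?A" for v
    using that by (auto simp: nsets_def)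
  have G2: "G \<subseteq> [{1..n}]\<^bsup>2\<^esup>" "finite G" if "G \<in> simple_graphs n" for G
    using that finite_imp_finite_nsets[of "{1..n}" 2] finite_subset by (auto simp: simple_graphs_def)
  have e_le: "?e G v \<le> ?N" if "G \<in> simple_graphs n" "v \<in> ?A" for G v
    using card_edges_inside_le[OF G2(1)[OF that(1)] v(1)[OF that(2)]] v(2)[OF that(2)] by simp
  \<comment> \<open>All angles lie in \<open>[0, pi]\<close>, so no cancellation between different
    graphs can occur: the total vanishes only if every product does.\<close>
  have nonneg: "0 \<le> ?P G" if "G \<in> simple_graphs n" for G
    using e_le[OF that] by (intro prod_nonneg) (simp add: sin_pi_frac_nonneg)
  have zero_iff: "?P G = 0 \<longleftrightarrow> (\<exists>K\<subseteq>{1..n}. card K = k \<and> (clique K G \<or> indep K G))"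
    if G: "G \<in> simple_graphs n" for G
  proof -
    \<comment> \<open>On \<open>[0, pi]\<close> the sine vanishes only at the endpoints, which are
      the extreme edge counts.\<close>
    have "?P G = 0 \<longleftrightarrow> (\<exists>v\<in>?A. ?e G v = 0 \<or> ?e G v = ?N)"
      unfolding prod_zero_iff[OF fA] using sin_pi_frac_eq_0_iff[OF e_le[OF G] N] by auto
    also have "\<dots> \<longleftrightarrow> (\<exists>v\<in>?A. clique v G \<or> indep v G)"
      using clique_iff_all_edges_inside[OF G2(1)[OF G]] indep_iff_no_edge_inside[OF G2[OF G]] v
      by metis
    also have "\<dots> \<longleftrightarrow> (\<exists>K\<subseteq>{1..n}. card K = k \<and> (clique K G \<or> indep K G))"
      by (auto simp: nsets_def dest: finite_subset)
    finally show ?thesis .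
  qed
  have "(\<Sum>G\<in>simple_graphs n. \<Sum>H\<in>uniform_hypergraphs k n.
            (-1) ^ card H * cos (4 * pi / (real k * (real k - 1)) * real (incidence_number G H)))
      = (-1) ^ M * (\<Sum>G\<in>simple_graphs n. ?P G)"
    using sum_hypergraphs_eq_prod_sin[OF assms(1) k2 _ m(1) M] by (simp add: sum_distrib_left)
  also have "\<dots> = 0 \<longleftrightarrow> (\<forall>G\<in>simple_graphs n. ?P G = 0)"
    using sum_nonneg_eq_0_iff[OF fG nonneg] by simp
  also have "\<dots> \<longleftrightarrow> ramsey_property k n"
    unfolding ramsey_property_iff_simple_graphs using zero_iff by simp
  also have "\<dots> \<longleftrightarrow> n \<ge> ramsey_number k"
    using ramsey_number_le_iff[of n k] assms by simp
  finally show ?thesis .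
qed

end
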